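(* Let $F$ be a distribution function on $[0,\infty)$ with $F(0)=0$, let $\alpha>0$, let $L\in RV_0$, and let $\beta,\lambda\ge0$ satisfy $\beta=\alpha\lambda$. Then the following statements are equivalent: (a) the function $x\mapsto x^\alpha\overline{G}_\alpha(x)$ belongs to $\Pi_\beta(L)$; (b) $x^\alpha\overline{F}(x)/L(x)\to\lambda$ as $x\to\infty$; (c) $H_\alpha\in\Pi_\beta(L)$.
   Context: For a distribution function $F$ on $[0,\infty)$ with $F(0)=0$, write $\overline{F}(x)=1-F(x)$. For $\alpha>0$ and $x>0$ define $H_\alpha(x)=\int_{[0,x]}y^\alpha\,dF(y)$ and the Williamson transform $G_\alpha(x)=\int_{[0,x]}\left(1-(t/x)^\alpha\right)dF(t)$, with $\overline{G}_\alpha(x)=1-G_\alpha(x)$. $RV_0$ is the class of slowly varying functions: (measurable, eventually positive) functions $L$ such that for every $t>0$, $L(tx)/L(x)\to1$ as $x\to\infty$. For $L\in RV_0$ and $\beta\in\mathbb{R}$, the de Haan class $\Pi_\beta(L)$ consists of the functions $f$ such that for every $t>1$, $(f(tx)-f(x))/L(x)\to\beta\log t$ as $x\to\infty$. *)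

theory Defs
  imports "HOL-Analysis.Analysis"
begin

text \<open>
  A distribution function on \<open>[0,\<infinity>)\<close> is a total function on the reals that
  vanishes on the negative half-line, so that \<open>dF\<close> is the Lebesgue--Stieltjes
  measure \<^const>\<open>interval_measure\<close> \<open>F\<close>.
\<close>

definition distribution_function_nonneg :: "(real \<Rightarrow> real) \<Rightarrow> bool" where
  "distribution_function_nonneg F \<longleftrightarrow>
     mono F \<and> (\<forall>x. continuous (at_right x) F) \<and>
     (\<forall>x<0. F x = 0) \<and> (F \<longlongrightarrow> 1) at_top"

definition tail :: "(real \<Rightarrow> real) \<Rightarrow> real \<Rightarrow> real" where
  "tail F x = 1 - F x"

definition trunc_moment :: "(real \<Rightarrow> real) \<Rightarrow> real \<Rightarrow> real \<Rightarrow> real" where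
  "trunc_moment F \<alpha> x = (LINT y:{0..x}|interval_measure F. y powr \<alpha>)"

definition williamson :: "(real \<Rightarrow> real) \<Rightarrow> real \<Rightarrow> real \<Rightarrow> real" where
  "williamson F \<alpha> x = (LINT t:{0..x}|interval_measure F. 1 - (t / x) powr \<alpha>)"

text \<open>
  The members of the following classes are functions on \<open>(0,\<infinity>)\<close>; the values of
  their total extensions elsewhere are irrelevant. Measurable means Lebesgue
  measurable, which includes the Borel measurable case.
\<close>

definition RV0 :: "(real \<Rightarrow> real) set" where
  "RV0 = {L. L \<in> borel_measurable (lebesgue_on {0<..}) \<and>
             (\<forall>\<^sub>F x in at_top. L x > 0) \<and>
             (\<forall>t>0. ((\<lambda>x. L (t * x) / L x) \<longlongrightarrow> 1) at_top)}"

definition de_Haan :: "real \<Rightarrow> (real \<Rightarrow> real) \<Rightarrow> (real \<Rightarrow> real) set" where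
  "de_Haan \<beta> L =
     {f. \<forall>t>1. ((\<lambda>x. (f (t * x) - f x) / L x) \<longlongrightarrow> \<beta> * ln t) at_top}"

end

theory Submission
  imports Defs "HOL-Real_Asymp.Real_Asymp"
begin

text \<open>
  Write \<open>T = 1 - F\<close>, \<open>H = H\<^sub>\<alpha>\<close> and \<open>U(x) = x\<^sup>\<alpha> (1 - G\<^sub>\<alpha>(x)) = x\<^sup>\<alpha> T(x) + H(x)\<close>. Bounding \<open>y\<^sup>\<alpha>\<close>
  on \<open>(x, tx]\<close> in \<open>H(tx) - H(x)\<close> by its endpoint values gives
  \<open>(t\<^sup>\<alpha> - 1) x\<^sup>\<alpha> T(tx) \<le> U(tx) - U(x) \<le> (t\<^sup>\<alpha> - 1) x\<^sup>\<alpha> T(x)\<close>, with no integration by parts.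
  Letting \<open>t \<rightarrow> 1\<close> yields (b) from (a). Conversely, splitting \<open>t = s\<^sup>n\<close> and applying the same bounds to
  each factor \<open>s\<close> yields (a) from (b) as \<open>n \<rightarrow> \<infinity>\<close>, and (c) follows because
  \<open>H(x) = U(x) - x\<^sup>\<alpha> T(x)\<close>. For (b) from (c), the endpoint bounds on \<open>H(tx) - H(x)\<close> control
  \<open>x\<^sup>\<alpha> (T(x) - T(tx))\<close>; summing along \<open>x, tx, t\<^sup>2x, \<dots>\<close> is geometric with ratio close to \<open>t\<^sup>-\<^sup>\<alpha>\<close>,
  since \<open>L(tx)/L(x) \<rightarrow> 1\<close>, and again \<open>t \<rightarrow> 1\<close>. Only pointwise convergence of \<open>L(tx)/L(x)\<close>
  enters, so the uniform convergence theorem for slowly varying functions is avoided.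
\<close>

section \<open>Squeeze principle and rescaling at infinity\<close>

text \<open>A squeeze in which, for fixed \<open>t\<close>, the bounds converge only to
  \<open>a t\<close> and \<open>b t\<close>, and these meet at \<open>c\<close> along
  \<open>G\<close>. For each \<open>m\<close> other than \<open>c\<close>, a single suitable
  \<open>t\<close> already separates \<open>f\<close> from \<open>m\<close>, so no uniformity in
  \<open>t\<close> is required.\<close>

lemma tendsto_sandwich_family:
  fixes f :: "'a \<Rightarrow> real"
  assumes "G \<noteq> bot"
    and lo: "\<forall>\<^sub>F t in G. \<exists>l. (\<forall>\<^sub>F x in A. l x \<le> f x) \<and> (l \<longlongrightarrow> a t) A"
    and hi: "\<forall>\<^sub>F t in G. \<exists>u. (\<forall>\<^sub>F x in A. f x \<le> u x) \<and> (u \<longlongrightarrow> b t) A"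
    and a: "(a \<longlongrightarrow> c) G" and b: "(b \<longlongrightarrow> c) G"
  shows "(f \<longlongrightarrow> c) A"
proof (rule order_tendstoI)
  fix m assume "m < c"
  then obtain t l where "m < a t" "\<forall>\<^sub>F x in A. l x \<le> f x" "(l \<longlongrightarrow> a t) A"
    using eventually_happens[OF eventually_conj[OF lo order_tendstoD(1)[OF a \<open>m < c\<close>]]] \<open>G \<noteq> bot\<close> by blast
  then show "\<forall>\<^sub>F x in A. m < f x"
    by (smt (verit) eventually_elim2 order_tendstoD(1))
next
  fix m assume "c < m"
  then obtain t u where "b t < m" "\<forall>\<^sub>F x in A. f x \<le> u x" "(u \<longlongrightarrow> b t) A"
    using eventually_happens[OF eventually_conj[OF hi order_tendstoD(2)[OF b \<open>c < m\<close>]]] \<open>G \<noteq> bot\<close> by blast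
  then show "\<forall>\<^sub>F x in A. f x < m"
    by (smt (verit) eventually_elim2 order_tendstoD(2))
qed

lemma tendsto_rescale:
  fixes t :: real
  assumes "(f \<longlongrightarrow> c) at_top" "t > 0"
  shows "((\<lambda>x. f (t * x)) \<longlongrightarrow> c) at_top"
  by (rule filterlim_compose[OF assms(1)])
    (use \<open>t > 0\<close> in \<open>simp add: filterlim_tendsto_pos_mult_at_top[OF tendsto_const] filterlim_ident\<close>)

lemma eventually_rescale:
  fixes t :: real
  assumes "\<forall>\<^sub>F x in at_top. P x" "t > 0"
  shows "\<forall>\<^sub>F x in at_top. P (t * x)"
proof -
  have "filterlim (\<lambda>x. t * x) at_top at_top"
    using \<open>t > 0\<close> by (simp add: filterlim_tendsto_pos_mult_at_top[OF tendsto_const] filterlim_ident)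
  then show ?thesis using assms(1) by (rule eventually_compose_filterlim[rotated])
qed

lemma RV0_pos: "L \<in> RV0 \<Longrightarrow> \<forall>\<^sub>F x in at_top. 0 < L x"
  by (simp add: RV0_def)

lemma RV0_ratio: "L \<in> RV0 \<Longrightarrow> 0 < t \<Longrightarrow> ((\<lambda>x. L (t * x) / L x) \<longlongrightarrow> 1) at_top"
  by (simp add: RV0_def)

lemma de_HaanD:
  "f \<in> de_Haan b L \<Longrightarrow> 1 < t \<Longrightarrow> ((\<lambda>x. (f (t * x) - f x) / L x) \<longlongrightarrow> b * ln t) at_top"
  by (simp add: de_Haan_def)

section \<open>Tail asymptotics versus increments of \<open>U\<close>\<close>

text \<open>Divided by \<open>t powr \<alpha> - 1\<close>, \<open>upper\<close> bounds
  \<open>x powr \<alpha> * T x\<close> from below by an increment of \<open>U\<close>. Likewise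
  \<open>lower\<close> bounds it from above, but at the point \<open>t * x\<close>. After division
  by \<open>L\<close> both bounds have limits that tend to \<open>\<mu>\<close> as \<open>t\<close>
  decreases to 1.\<close>

lemma tail_asymp_if_de_Haan:
  fixes T U L :: "real \<Rightarrow> real"
  assumes "\<alpha> > 0" and L: "L \<in> RV0"
    and lower: "\<And>x t. x > 0 \<Longrightarrow> t > 1 \<Longrightarrow>
      (t powr \<alpha> - 1) * (x powr \<alpha> * T (t * x)) \<le> U (t * x) - U x"
    and upper: "\<And>x t. x > 0 \<Longrightarrow> t > 1 \<Longrightarrow>
      U (t * x) - U x \<le> (t powr \<alpha> - 1) * (x powr \<alpha> * T x)"
    and U: "U \<in> de_Haan (\<alpha> * \<mu>) L"
  shows "((\<lambda>x. x powr \<alpha> * T x / L x) \<longlongrightarrow> \<mu>) at_top"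
proof (rule tendsto_sandwich_family[where G = "at_right (0::real)"])
  have pos: "\<forall>\<^sub>F h in at_right (0::real). h > 0" by (simp add: eventually_at_right_less)
  show "\<forall>\<^sub>F h in at_right 0. \<exists>l. (\<forall>\<^sub>F x in at_top. l x \<le> x powr \<alpha> * T x / L x) \<and>
      (l \<longlongrightarrow> \<alpha> * \<mu> * h / (exp (\<alpha> * h) - 1)) at_top"
    using pos
  proof eventually_elim
    case (elim h)
    \<comment> \<open>With \<open>t = exp h\<close> one has \<open>ln t = h\<close>, so the passage
      of \<open>t\<close> to 1 becomes \<open>h\<close> tending to 0 from the right.\<close>
    define t where "t = exp h"
    have t: "t > 1" "ln t = h" "t powr \<alpha> = exp (\<alpha> * h)" "exp (\<alpha> * h) - 1 > 0"
      using elim \<open>\<alpha> > 0\<close> by (simp_all add: t_def powr_def)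
    let ?l = "\<lambda>x. (U (t * x) - U x) / L x / (exp (\<alpha> * h) - 1)"
    have "\<forall>\<^sub>F x in at_top. ?l x \<le> x powr \<alpha> * T x / L x"
      using RV0_pos[OF L] eventually_gt_at_top[of 0]
    proof eventually_elim
      case (elim x)
      have "(U (t * x) - U x) / (exp (\<alpha> * h) - 1) \<le> x powr \<alpha> * T x"
        using upper[OF elim(2) t(1)] t by (simp add: pos_divide_le_eq mult.commute)
      from divide_right_mono[OF this, of "L x"] show ?case
        using elim by (simp add: mult.commute)
    qed
    moreover have "(?l \<longlongrightarrow> \<alpha> * \<mu> * h / (exp (\<alpha> * h) - 1)) at_top"
      by (intro tendsto_divide tendsto_const de_HaanD[OF U t(1), unfolded t(2)]) (use t(4) in linarith)
    ultimately show ?case by (intro exI conjI)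
  qed
  show "\<forall>\<^sub>F h in at_right 0. \<exists>u. (\<forall>\<^sub>F x in at_top. x powr \<alpha> * T x / L x \<le> u x) \<and>
      (u \<longlongrightarrow> \<alpha> * \<mu> * h * (exp (\<alpha> * h) / (exp (\<alpha> * h) - 1))) at_top"
    using pos
  proof eventually_elim
    case (elim h)
    define t where "t = exp h"
    have t: "t > 1" "ln t = h" "t powr \<alpha> = exp (\<alpha> * h)" "exp (\<alpha> * h) - 1 > 0"
      using elim \<open>\<alpha> > 0\<close> by (simp_all add: t_def powr_def)
    \<comment> \<open>The factor \<open>L x / L (t * x)\<close> moves the normalisation to the point
      where \<open>lower\<close> evaluates \<open>T\<close>; the numerator
      \<open>exp (\<alpha> * h)\<close> turns \<open>x powr \<alpha>\<close> into
      \<open>(t * x) powr \<alpha>\<close>.\<close>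
    define v where "v x = (U (t * x) - U x) / L x * (L x / L (t * x)) * (exp (\<alpha> * h) / (exp (\<alpha> * h) - 1))" for x
    have v: "(v \<longlongrightarrow> \<alpha> * \<mu> * h * (exp (\<alpha> * h) / (exp (\<alpha> * h) - 1))) at_top"
      unfolding v_def
      using tendsto_mult[OF tendsto_mult[OF de_HaanD[OF U t(1)] tendsto_inverse[OF RV0_ratio[OF L, of t]]]
          tendsto_const[of "exp (\<alpha> * h) / (exp (\<alpha> * h) - 1)"]] t by simp
    have ev: "\<forall>\<^sub>F x in at_top. (t * x) powr \<alpha> * T (t * x) / L (t * x) \<le> v x"
      using RV0_pos[OF L] eventually_gt_at_top[of 0] eventually_rescale[OF RV0_pos[OF L], of t, OF less_trans[OF zero_less_one t(1)]]
    proof eventually_elim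
      case (elim x)
      have "v x = (U (t * x) - U x) * exp (\<alpha> * h) / ((exp (\<alpha> * h) - 1) * L (t * x))"
        using elim by (simp add: v_def)
      moreover have "(t * x) powr \<alpha> = exp (\<alpha> * h) * x powr \<alpha>"
        using t elim by (simp add: powr_mult)
      moreover have "x powr \<alpha> * T (t * x) \<le> (U (t * x) - U x) / (exp (\<alpha> * h) - 1)"
        using lower[OF elim(2) t(1)] t by (simp add: pos_le_divide_eq mult.commute)
      from mult_right_mono[OF this, of "exp (\<alpha> * h) / L (t * x)"]
      have "x powr \<alpha> * T (t * x) * (exp (\<alpha> * h) / L (t * x))
          \<le> (U (t * x) - U x) / (exp (\<alpha> * h) - 1) * (exp (\<alpha> * h) / L (t * x))"
        using elim by simp
      ultimately show ?case by (simp add: mult_ac)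
    qed
    \<comment> \<open>Replacing \<open>x\<close> by \<open>inverse t * x\<close> brings the bound at
      \<open>t * x\<close> back to \<open>x\<close>.\<close>
    have "t * (inverse t * x) = x" for x using t(1) by (simp add: field_simps)
    with eventually_rescale[OF ev, of "inverse t"]
    have "\<forall>\<^sub>F x in at_top. x powr \<alpha> * T x / L x \<le> v (inverse t * x)"
      using t(1) by simp
    moreover have "((\<lambda>x. v (inverse t * x)) \<longlongrightarrow> \<alpha> * \<mu> * h * (exp (\<alpha> * h) / (exp (\<alpha> * h) - 1))) at_top"
      by (rule tendsto_rescale[OF v]) (use t in simp)
    ultimately show ?case by (intro exI conjI)
  qed
  have mu: "\<alpha> * \<mu> * inverse \<alpha> = \<mu>" using \<open>\<alpha> > 0\<close> by simp
  have "((\<lambda>h. h / (exp (\<alpha> * h) - 1)) \<longlongrightarrow> inverse \<alpha>) (at_right 0)"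
    using \<open>\<alpha> > 0\<close> by real_asymp
  from tendsto_mult[OF tendsto_const[of "\<alpha> * \<mu>"] this]
  show "((\<lambda>h. \<alpha> * \<mu> * h / (exp (\<alpha> * h) - 1)) \<longlongrightarrow> \<mu>) (at_right 0)" by (simp add: mu)
  have "((\<lambda>h. h * (exp (\<alpha> * h) / (exp (\<alpha> * h) - 1))) \<longlongrightarrow> inverse \<alpha>) (at_right 0)"
    using \<open>\<alpha> > 0\<close> by real_asymp
  from tendsto_mult[OF tendsto_const[of "\<alpha> * \<mu>"] this]
  show "((\<lambda>h. \<alpha> * \<mu> * h * (exp (\<alpha> * h) / (exp (\<alpha> * h) - 1))) \<longlongrightarrow> \<mu>) (at_right 0)"
    by (simp add: mu mult.assoc[of "\<alpha> * \<mu>"])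
qed simp

text \<open>One step from \<open>x\<close> to \<open>t * x\<close> only traps the limit between
  \<open>(1 - t powr - \<alpha>) * \<mu>\<close> and \<open>(t powr \<alpha> - 1) * \<mu>\<close>.
  With \<open>n\<close> steps of ratio \<open>s\<close> and \<open>s ^ n = t\<close>, both bounds
  become \<open>n\<close> times the analogous quantity for \<open>s\<close>, and both tend to
  \<open>\<alpha> * \<mu> * ln t\<close>.\<close>

lemma de_Haan_if_tail_asymp:
  fixes T U L :: "real \<Rightarrow> real"
  assumes "\<alpha> > 0" and L: "L \<in> RV0"
    and lower: "\<And>x t. x > 0 \<Longrightarrow> t > 1 \<Longrightarrow>
      (t powr \<alpha> - 1) * (x powr \<alpha> * T (t * x)) \<le> U (t * x) - U x"
    and upper: "\<And>x t. x > 0 \<Longrightarrow> t > 1 \<Longrightarrow>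
      U (t * x) - U x \<le> (t powr \<alpha> - 1) * (x powr \<alpha> * T x)"
    and T: "((\<lambda>x. x powr \<alpha> * T x / L x) \<longlongrightarrow> \<mu>) at_top"
  shows "U \<in> de_Haan (\<alpha> * \<mu>) L"
proof -
  \<comment> \<open>All summands below share the denominator \<open>L x\<close>, while the tail is
    taken at \<open>s * x\<close>; slow variation pays for the mismatch.\<close>
  have T': "((\<lambda>x. (s * x) powr \<alpha> * T (s * x) / L x) \<longlongrightarrow> \<mu>) at_top" if "s > 0" for s
  proof -
    have "((\<lambda>x. ((s * x) powr \<alpha> * T (s * x) / L (s * x)) * (L (s * x) / L x)) \<longlongrightarrow> \<mu>) at_top"
      using tendsto_mult[OF tendsto_rescale[OF T that] RV0_ratio[OF L that]] by simp
    then show ?thesis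
      by (rule Lim_transform_eventually)
        (use eventually_rescale[OF RV0_pos[OF L] that] in \<open>auto elim: eventually_mono\<close>)
  qed
  have "((\<lambda>x. (U (t * x) - U x) / L x) \<longlongrightarrow> \<alpha> * \<mu> * ln t) at_top" if "t > 1" for t
  proof (rule tendsto_sandwich_family[where G = sequentially])
    define s where "s n = exp (ln t / real n)" for n
    have s: "s n > 1" "s n ^ n = t" "s n powr \<alpha> = exp (\<alpha> * ln t / n)" if "n > 0" for n
      using that \<open>t > 1\<close> by (simp_all add: s_def powr_def flip: exp_of_nat_mult)
    have tele: "(U (t * x) - U x) / L x = (\<Sum>k<n. (U (s n ^ Suc k * x) - U (s n ^ k * x)) / L x)" if "n > 0" for n x
      using sum_lessThan_telescope[of "\<lambda>k. U (s n ^ k * x) / L x" n] s[OF that]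
      by (simp add: diff_divide_distrib)
    let ?c = "\<lambda>n::nat. exp (\<alpha> * ln t / n) - 1"
    have ev: "\<forall>\<^sub>F n::nat in sequentially. n > 0" by (rule eventually_gt_at_top)
    show "\<forall>\<^sub>F n in sequentially. \<exists>u. (\<forall>\<^sub>F x in at_top. (U (t * x) - U x) / L x \<le> u x) \<and>
      (u \<longlongrightarrow> (\<Sum>k<n. ?c n * \<mu>)) at_top"
      using ev
    proof eventually_elim
      case (elim n)
      let ?u = "\<lambda>x. \<Sum>k<n. ?c n * ((s n ^ k * x) powr \<alpha> * T (s n ^ k * x) / L x)"
      have "\<forall>\<^sub>F x in at_top. (U (t * x) - U x) / L x \<le> ?u x"
        using RV0_pos[OF L] eventually_gt_at_top[of 0]
      proof eventually_elim
        case x: (elim x)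
        show ?case unfolding tele[OF elim]
        proof (rule sum_mono)
          fix k
          have "s n ^ k * x > 0" using x s[OF elim] by simp
          from divide_right_mono[OF upper[OF this s(1)[OF elim]], of "L x"] x s[OF elim]
          show "(U (s n ^ Suc k * x) - U (s n ^ k * x)) / L x \<le> ?c n * ((s n ^ k * x) powr \<alpha> * T (s n ^ k * x) / L x)"
            by (simp add: mult.assoc)
        qed
      qed
      moreover have "(?u \<longlongrightarrow> (\<Sum>k<n. ?c n * \<mu>)) at_top"
        by (intro tendsto_sum tendsto_mult tendsto_const T') (use s(1)[OF elim] in simp)
      ultimately show ?case by (intro exI conjI)
    qed
    \<comment> \<open>\<open>lower\<close> pairs \<open>T\<close> at the right end of a step with
      the weight at its left end. Moving the weight to the right end costs the division by
      \<open>s n powr \<alpha>\<close>.\<close>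
    let ?d = "\<lambda>n::nat. ?c n / exp (\<alpha> * ln t / n)"
    show "\<forall>\<^sub>F n in sequentially. \<exists>l. (\<forall>\<^sub>F x in at_top. l x \<le> (U (t * x) - U x) / L x) \<and>
      (l \<longlongrightarrow> (\<Sum>k<n. ?d n * \<mu>)) at_top"
      using ev
    proof eventually_elim
      case (elim n)
      let ?l = "\<lambda>x. \<Sum>k<n. ?d n * ((s n ^ Suc k * x) powr \<alpha> * T (s n ^ Suc k * x) / L x)"
      have "\<forall>\<^sub>F x in at_top. ?l x \<le> (U (t * x) - U x) / L x"
        using RV0_pos[OF L] eventually_gt_at_top[of 0]
      proof eventually_elim
        case x: (elim x)
        show ?case unfolding tele[OF elim]
        proof (rule sum_mono)
          fix k
          have p: "s n ^ k * x > 0" using x s[OF elim] by simp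
          have "(s n ^ Suc k * x) powr \<alpha> = exp (\<alpha> * ln t / n) * (s n ^ k * x) powr \<alpha>"
            using powr_mult[of "s n" "s n ^ k * x" \<alpha>] p s[OF elim] by (simp add: mult.assoc)
          with divide_right_mono[OF lower[OF p s(1)[OF elim]], of "L x"] x s[OF elim]
          show "?d n * ((s n ^ Suc k * x) powr \<alpha> * T (s n ^ Suc k * x) / L x) \<le> (U (s n ^ Suc k * x) - U (s n ^ k * x)) / L x"
            by (simp add: mult.assoc)
        qed
      qed
      moreover have "(?l \<longlongrightarrow> (\<Sum>k<n. ?d n * \<mu>)) at_top"
        by (intro tendsto_sum tendsto_mult tendsto_const T') (use s(1)[OF elim] in simp)
      ultimately show ?case by (intro exI conjI)
    qed
    have "ln t > 0" using \<open>t > 1\<close> by simp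
    then have a: "\<alpha> * ln t > 0" using \<open>\<alpha> > 0\<close> by simp
    have "(\<lambda>n. real n * (exp (a / n) - 1)) \<longlonglongrightarrow> a" if "a > 0" for a :: real
      using that by real_asymp
    from tendsto_mult[OF this[OF a] tendsto_const[of \<mu>]]
    show "(\<lambda>n. \<Sum>k<n. ?c n * \<mu>) \<longlonglongrightarrow> \<alpha> * \<mu> * ln t" by (simp add: mult_ac)
    have "(\<lambda>n. real n * ((exp (a / n) - 1) / exp (a / n))) \<longlonglongrightarrow> a" if "a > 0" for a :: real
      using that by real_asymp
    from tendsto_mult[OF this[OF a] tendsto_const[of \<mu>]]
    show "(\<lambda>n. \<Sum>k<n. ?d n * \<mu>) \<longlonglongrightarrow> \<alpha> * \<mu> * ln t" by (simp add: mult_ac)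
  qed simp
  then show ?thesis by (simp add: de_Haan_def)
qed

section \<open>Recovering the tail from its increments\<close>

text \<open>Telescoping along \<open>t ^ k * x\<close>, the \<open>k\<close>-th weighted increment
  is at most \<open>c * q ^ k * L x\<close>, so the sum is dominated by a geometric series; the
  remainder vanishes because \<open>T\<close> tends to 0.\<close>

lemma iterated_increment_upper:
  fixes T L :: "real \<Rightarrow> real"
  assumes "t > 1" "0 \<le> q" "q < 1" "c \<ge> 0" "N > 0"
    and L: "\<And>x. x \<ge> N \<Longrightarrow> L x > 0"
    and ratio: "\<And>x. x \<ge> N \<Longrightarrow> t powr - \<alpha> * L (t * x) \<le> q * L x"
    and incr: "\<And>x. x \<ge> N \<Longrightarrow> x powr \<alpha> * (T x - T (t * x)) \<le> c * L x"
    and T: "(T \<longlongrightarrow> 0) at_top" and x: "x \<ge> N"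
  shows "x powr \<alpha> * T x \<le> c / (1 - q) * L x"
proof -
  have fin: "x powr \<alpha> * (T x - T (t ^ n * x)) \<le> c / (1 - q) * L x" if "x \<ge> N" for n x
    using that
  proof (induction n arbitrary: x)
    case 0
    then have "L x > 0" by (rule L)
    with assms(3,4) show ?case by simp
  next
    case (Suc n)
    have "x > 0" using Suc.prems \<open>N > 0\<close> by simp
    then have tx: "t * x \<ge> N" "x > 0"
      using mult_right_mono[of 1 t x] Suc.prems \<open>t > 1\<close> by linarith+
    have "(t * x) powr \<alpha> = t powr \<alpha> * x powr \<alpha>" using tx \<open>t > 1\<close> by (simp add: powr_mult)
    \<comment> \<open>Shifting the weight to \<open>t * x\<close> allows the induction hypothesis
      there; the factor \<open>t powr - \<alpha>\<close> is then absorbed by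
      \<open>ratio\<close>.\<close>
    then have e: "x powr \<alpha> = t powr - \<alpha> * (t * x) powr \<alpha>"
      using \<open>t > 1\<close> by (simp add: powr_minus field_simps)
    have "x powr \<alpha> * (T (t * x) - T (t ^ n * (t * x))) =
        t powr - \<alpha> * ((t * x) powr \<alpha> * (T (t * x) - T (t ^ n * (t * x))))"
      unfolding e by simp
    also have "\<dots> \<le> t powr - \<alpha> * (c / (1 - q) * L (t * x))"
      by (intro mult_left_mono Suc.IH tx) simp
    also have "\<dots> = c / (1 - q) * (t powr - \<alpha> * L (t * x))" by simp
    also have "\<dots> \<le> c / (1 - q) * (q * L x)"
      by (intro mult_left_mono ratio Suc.prems) (use assms in simp)
    finally have "x powr \<alpha> * (T x - T (t ^ n * (t * x))) \<le> c * L x + c / (1 - q) * (q * L x)"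
      using incr[OF Suc.prems] by (simp add: algebra_simps)
    \<comment> \<open>The full sum \<open>C = c / (1 - q)\<close> is the fixed point of
      \<open>C = c + q * C\<close>, so the same bound serves every \<open>n\<close>.\<close>
    also have "\<dots> = c / (1 - q) * L x" using \<open>q < 1\<close> by (simp add: field_simps)
    finally show ?case by (simp add: mult_ac)
  qed
  have "filterlim (\<lambda>n. t ^ n * x) at_top sequentially"
    using x \<open>N > 0\<close> \<open>t > 1\<close> by real_asymp
  from filterlim_compose[OF T this]
  have "(\<lambda>n. x powr \<alpha> * (T x - T (t ^ n * x))) \<longlonglongrightarrow> x powr \<alpha> * (T x - 0)"
    by (intro tendsto_intros)
  then show ?thesis
    using fin[OF x] by (intro LIMSEQ_le_const2[of _ "x powr \<alpha> * T x"]) auto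
qed

text \<open>The same telescoping from below: the remainder is dropped as nonnegative. The induction
  carries the partial geometric sum, which starts at 0, and the full sum appears as \<open>n\<close>
  grows.\<close>

lemma iterated_increment_lower:
  fixes T L :: "real \<Rightarrow> real"
  assumes "t > 1" "0 \<le> q" "q < 1" "c \<ge> 0" "N > 0"
    and T: "\<And>x. T x \<ge> 0"
    and ratio: "\<And>x. x \<ge> N \<Longrightarrow> q * L x \<le> t powr - \<alpha> * L (t * x)"
    and incr: "\<And>x. x \<ge> N \<Longrightarrow> c * L x \<le> x powr \<alpha> * (T x - T (t * x))"
    and x: "x \<ge> N"
  shows "c / (1 - q) * L x \<le> x powr \<alpha> * T x"
proof -
  have fin: "c * (1 - q ^ n) / (1 - q) * L x \<le> x powr \<alpha> * T x" if "x \<ge> N" for n x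
    using that
  proof (induction n arbitrary: x)
    case 0
    then show ?case using T[of x] by simp
  next
    case (Suc n)
    have "x > 0" using Suc.prems \<open>N > 0\<close> by simp
    then have tx: "t * x \<ge> N" "x > 0"
      using mult_right_mono[of 1 t x] Suc.prems \<open>t > 1\<close> by linarith+
    have "(t * x) powr \<alpha> = t powr \<alpha> * x powr \<alpha>" using tx \<open>t > 1\<close> by (simp add: powr_mult)
    then have e: "x powr \<alpha> = t powr - \<alpha> * (t * x) powr \<alpha>"
      using \<open>t > 1\<close> by (simp add: powr_minus field_simps)
    have "c * (1 - q ^ Suc n) / (1 - q) * L x = c * L x + c * (1 - q ^ n) / (1 - q) * (q * L x)"
      using \<open>q < 1\<close> by (simp add: field_simps)
    also have "\<dots> \<le> c * L x + c * (1 - q ^ n) / (1 - q) * (t powr - \<alpha> * L (t * x))"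
      by (intro add_left_mono mult_left_mono ratio Suc.prems)
        (use assms power_le_one[of q n] in simp)
    also have "\<dots> = c * L x + t powr - \<alpha> * (c * (1 - q ^ n) / (1 - q) * L (t * x))" by simp
    also have "\<dots> \<le> c * L x + t powr - \<alpha> * ((t * x) powr \<alpha> * T (t * x))"
      by (intro add_left_mono mult_left_mono Suc.IH tx) simp
    also have "\<dots> = c * L x + x powr \<alpha> * T (t * x)" unfolding e by simp
    also have "\<dots> \<le> x powr \<alpha> * T x" using incr[OF Suc.prems] by (simp add: algebra_simps)
    finally show ?case .
  qed
  have "(\<lambda>n. q ^ n) \<longlonglongrightarrow> 0" using assms by (simp add: LIMSEQ_realpow_zero)
  then have "(\<lambda>n. c * (1 - q ^ n) / (1 - q) * L x) \<longlonglongrightarrow> c * (1 - 0) / (1 - q) * L x"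
    using \<open>q < 1\<close> by (intro tendsto_mult tendsto_divide tendsto_diff tendsto_const) auto
  then show ?thesis
    using fin[OF x] by (intro LIMSEQ_le_const2[of _ "c / (1 - q) * L x"]) auto
qed

lemma tail_asymp_if_moment_de_Haan:
  fixes T H L :: "real \<Rightarrow> real"
  assumes "\<alpha> > 0" "\<mu> \<ge> 0" and L: "L \<in> RV0"
    and T: "(T \<longlongrightarrow> 0) at_top" "\<And>x. T x \<ge> 0"
    and lower: "\<And>x y. 0 < x \<Longrightarrow> x < y \<Longrightarrow> x powr \<alpha> * (T x - T y) \<le> H y - H x"
    and upper: "\<And>x y. 0 < x \<Longrightarrow> x < y \<Longrightarrow> H y - H x \<le> y powr \<alpha> * (T x - T y)"
    and H: "H \<in> de_Haan (\<alpha> * \<mu>) L"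
  shows "((\<lambda>x. x powr \<alpha> * T x / L x) \<longlongrightarrow> \<mu>) at_top"
\<comment> \<open>Take \<open>t = exp h\<close> and relative error \<open>h\<^sup>2\<close>: it is negligible against \<open>1 - t powr - \<alpha>\<close>, which is
  of order \<open>h\<close>, so a single limit \<open>h \<rightarrow> 0\<close> replaces the two limits in error and \<open>t\<close>.\<close>
proof (rule tendsto_sandwich_family[where G = "at_right (0::real)"])
  define B where "B = \<alpha> * \<mu>"
  have "B \<ge> 0" using assms by (simp add: B_def)
  \<comment> \<open>The iteration visits every \<open>t ^ k * x\<close>, so the eventual estimates
    are collected beyond one common positive threshold.\<close>
  have good: "\<exists>x0>0. \<forall>x\<ge>x0. L x > 0 \<and> L (exp h * x) \<le> (1 + h\<^sup>2) * L x \<and> (1 - h\<^sup>2) * L x \<le> L (exp h * x)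
      \<and> H (exp h * x) - H x \<le> (B * h + h\<^sup>2) * L x \<and> (B * h - h\<^sup>2) * L x \<le> H (exp h * x) - H x"
    if "h > 0" for h
  proof -
    have h2: "h\<^sup>2 > 0" using that by simp
    have "\<forall>\<^sub>F x in at_top. \<bar>L (exp h * x) / L x - 1\<bar> < h\<^sup>2"
      using tendstoD[OF RV0_ratio[OF L] h2, of "exp h"] by (simp add: dist_real_def)
    moreover have "\<forall>\<^sub>F x in at_top. \<bar>(H (exp h * x) - H x) / L x - B * h\<bar> < h\<^sup>2"
      using tendstoD[OF de_HaanD[OF H] h2, of "exp h"] that by (simp add: dist_real_def B_def)
    ultimately have "\<forall>\<^sub>F x in at_top. L x > 0 \<and> L (exp h * x) \<le> (1 + h\<^sup>2) * L x \<and> (1 - h\<^sup>2) * L x \<le> L (exp h * x)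
      \<and> H (exp h * x) - H x \<le> (B * h + h\<^sup>2) * L x \<and> (B * h - h\<^sup>2) * L x \<le> H (exp h * x) - H x"
      using RV0_pos[OF L]
    proof eventually_elim
      case (elim x)
      have r: "p \<le> (c + h\<^sup>2) * L x \<and> (c - h\<^sup>2) * L x \<le> p" if "\<bar>p / L x - c\<bar> < h\<^sup>2" for p c
      proof -
        have "p / L x \<le> c + h\<^sup>2" "c - h\<^sup>2 \<le> p / L x" using that by linarith+
        then show ?thesis using elim(3) by (simp add: divide_le_eq le_divide_eq)
      qed
      show ?case using r[OF elim(1)] r[OF elim(2)] elim(3) by blast
    qed
    then obtain N where N: "\<forall>x\<ge>N. L x > 0 \<and> L (exp h * x) \<le> (1 + h\<^sup>2) * L x \<and> (1 - h\<^sup>2) * L x \<le> L (exp h * x)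
      \<and> H (exp h * x) - H x \<le> (B * h + h\<^sup>2) * L x \<and> (B * h - h\<^sup>2) * L x \<le> H (exp h * x) - H x"
      unfolding eventually_at_top_linorder by blast
    show ?thesis by (rule exI[of _ "max N 1"]) (use N in auto)
  qed
  have pos: "\<forall>\<^sub>F h in at_right (0::real). h > 0" by (simp add: eventually_at_right_less)
  have small: "\<forall>\<^sub>F h in at_right (0::real). h < 1"
    by (rule eventually_at_right_real[of 0 1, THEN eventually_mono]) auto
  \<comment> \<open>To first order the ratio is \<open>1 - \<alpha> * h\<close>, since the error
    \<open>h\<^sup>2\<close> is of smaller order; hence it is below 1 for small
    \<open>h\<close>.\<close>
  have q1: "\<forall>\<^sub>F h in at_right (0::real). exp (- \<alpha> * h) * (1 + h\<^sup>2) < 1"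
    using \<open>\<alpha> > 0\<close> by real_asymp
  have expa: "exp h powr - \<alpha> = exp (- \<alpha> * h)" "exp h powr \<alpha> = exp (\<alpha> * h)" for h
    by (simp_all add: powr_def)
  let ?b = "\<lambda>h. (B * h + h\<^sup>2) / (1 - exp (- \<alpha> * h) * (1 + h\<^sup>2))"
  \<comment> \<open>The iteration needs a nonnegative constant, but \<open>B * h - h\<^sup>2\<close>
    is negative when \<open>B = 0\<close>, hence the \<open>max 0\<close>. The factor
    \<open>exp (- \<alpha> * h)\<close> comes from the weight at the right endpoint in
    \<open>upper\<close>.\<close>
  let ?a = "\<lambda>h. max 0 ((B * h - h\<^sup>2) * exp (- \<alpha> * h)) / (1 - exp (- \<alpha> * h) * (1 - h\<^sup>2))"
  show "\<forall>\<^sub>F h in at_right 0. \<exists>u. (\<forall>\<^sub>F x in at_top. x powr \<alpha> * T x / L x \<le> u x) \<and> (u \<longlongrightarrow> ?b h) at_top"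
    using pos q1
  proof eventually_elim
    case (elim h)
    obtain x0 where x0: "x0 > 0" and g: "\<And>x. x \<ge> x0 \<Longrightarrow> L x > 0 \<and> L (exp h * x) \<le> (1 + h\<^sup>2) * L x
      \<and> H (exp h * x) - H x \<le> (B * h + h\<^sup>2) * L x"
      using good[OF elim(1)] by blast
    have bound: "x powr \<alpha> * T x \<le> ?b h * L x" if "x \<ge> x0" for x
    proof (rule iterated_increment_upper[where t = "exp h" and N = x0, OF _ _ elim(2) _ x0])
      fix x assume x: "x \<ge> x0"
      show "exp h powr - \<alpha> * L (exp h * x) \<le> exp (- \<alpha> * h) * (1 + h\<^sup>2) * L x"
        using g[OF x] by (simp add: expa mult.assoc)
      show "x powr \<alpha> * (T x - T (exp h * x)) \<le> (B * h + h\<^sup>2) * L x"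
        using lower[of x "exp h * x"] x x0 elim g[OF x] by simp
    qed (use elim \<open>B \<ge> 0\<close> g T that in auto)
    have "\<forall>\<^sub>F x in at_top. x powr \<alpha> * T x / L x \<le> ?b h"
      using eventually_ge_at_top[of x0]
    proof eventually_elim
      case (elim x)
      show ?case using bound[OF elim] g[OF elim] by (simp only: pos_divide_le_eq)
    qed
    then show ?case by (intro exI[of _ "\<lambda>_. ?b h"] conjI tendsto_const)
  qed
  show "\<forall>\<^sub>F h in at_right 0. \<exists>l. (\<forall>\<^sub>F x in at_top. l x \<le> x powr \<alpha> * T x / L x) \<and> (l \<longlongrightarrow> ?a h) at_top"
    using pos small
  proof eventually_elim
    case (elim h)
    obtain x0 where x0: "x0 > 0" and g: "\<And>x. x \<ge> x0 \<Longrightarrow> L x > 0 \<and> (1 - h\<^sup>2) * L x \<le> L (exp h * x)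
      \<and> (B * h - h\<^sup>2) * L x \<le> H (exp h * x) - H x"
      using good[OF elim(1)] by blast
    have "h\<^sup>2 < 1" "h\<^sup>2 > 0" using elim by (auto simp: power_less_one_iff)
    have "exp (- \<alpha> * h) < 1" using elim \<open>\<alpha> > 0\<close> by simp
    have q: "exp (- \<alpha> * h) * (1 - h\<^sup>2) < 1"
      using \<open>h\<^sup>2 > 0\<close> \<open>h\<^sup>2 < 1\<close> \<open>exp (- \<alpha> * h) < 1\<close>
      by (smt (verit) exp_gt_zero mult_less_cancel_left2 mult_le_one)
    have bound: "?a h * L x \<le> x powr \<alpha> * T x" if "x \<ge> x0" for x
    proof (rule iterated_increment_lower[where t = "exp h" and N = x0, OF _ _ q _ x0])
      fix x assume x: "x \<ge> x0"
      show "exp (- \<alpha> * h) * (1 - h\<^sup>2) * L x \<le> exp h powr - \<alpha> * L (exp h * x)"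
        using g[OF x] by (simp add: expa mult.assoc)
      have xp: "x > 0" "x < exp h * x" using x x0 elim by auto
      \<comment> \<open>Monotonicity of \<open>T\<close> is extracted from \<open>lower\<close> and
        \<open>upper\<close> together: the larger weight gives the larger product, so the difference
        cannot be negative.\<close>
      have "0 \<le> T x - T (exp h * x)"
      proof -
        have "x powr \<alpha> * (T x - T (exp h * x)) \<le> (exp h * x) powr \<alpha> * (T x - T (exp h * x))"
          using lower[OF xp] upper[OF xp] by linarith
        moreover have "x powr \<alpha> < (exp h * x) powr \<alpha>" using xp \<open>\<alpha> > 0\<close> by (simp add: powr_less_mono2)
        ultimately show ?thesis by (simp add: mult_le_cancel_right)
      qed
      moreover have "(B * h - h\<^sup>2) * exp (- \<alpha> * h) * L x \<le> x powr \<alpha> * (T x - T (exp h * x))"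
      proof -
        have "(B * h - h\<^sup>2) * L x \<le> exp (\<alpha> * h) * (x powr \<alpha> * (T x - T (exp h * x)))"
          using upper[OF xp] g[OF x] xp by (simp add: powr_mult expa mult.assoc)
        from mult_left_mono[OF this, of "exp (- \<alpha> * h)"]
        have "exp (- \<alpha> * h) * ((B * h - h\<^sup>2) * L x)
            \<le> exp (- \<alpha> * h) * (exp (\<alpha> * h) * (x powr \<alpha> * (T x - T (exp h * x))))"
          by simp
        also have "\<dots> = x powr \<alpha> * (T x - T (exp h * x))"
          by (simp add: exp_minus)
        finally show ?thesis by (simp only: mult_ac)
      qed
      ultimately show "max 0 ((B * h - h\<^sup>2) * exp (- \<alpha> * h)) * L x \<le> x powr \<alpha> * (T x - T (exp h * x))"
        by (simp add: max_def)
    qed (use elim g T that \<open>h\<^sup>2 < 1\<close> in auto)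
    have "\<forall>\<^sub>F x in at_top. ?a h \<le> x powr \<alpha> * T x / L x"
      using eventually_ge_at_top[of x0]
    proof eventually_elim
      case (elim x)
      show ?case using bound[OF elim] g[OF elim] by (simp only: pos_le_divide_eq)
    qed
    then show ?case by (intro exI[of _ "\<lambda>_. ?a h"] conjI tendsto_const)
  qed
  have B: "B * inverse \<alpha> = \<mu>" using \<open>\<alpha> > 0\<close> by (simp add: B_def)
  have "((\<lambda>h. h / (1 - exp (- \<alpha> * h) * (1 + h\<^sup>2))) \<longlongrightarrow> inverse \<alpha>) (at_right 0)"
    "((\<lambda>h. h\<^sup>2 / (1 - exp (- \<alpha> * h) * (1 + h\<^sup>2))) \<longlongrightarrow> 0) (at_right 0)"
    using \<open>\<alpha> > 0\<close> by (real_asymp, real_asymp)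
  from tendsto_add[OF tendsto_mult[OF tendsto_const[of B] this(1)] this(2)]
  show "(?b \<longlongrightarrow> \<mu>) (at_right 0)" by (simp add: B add_divide_distrib)
  have lims: "((\<lambda>h. h * exp (- \<alpha> * h) / (1 - exp (- \<alpha> * h) * (1 - h\<^sup>2))) \<longlongrightarrow> inverse \<alpha>) (at_right 0)"
    "((\<lambda>h. h\<^sup>2 * exp (- \<alpha> * h) / (1 - exp (- \<alpha> * h) * (1 - h\<^sup>2))) \<longlongrightarrow> 0) (at_right 0)"
    "\<forall>\<^sub>F h in at_right (0::real). exp (- \<alpha> * h) * (1 - h\<^sup>2) < 1"
    using \<open>\<alpha> > 0\<close> by (real_asymp, real_asymp, real_asymp)
  have "((\<lambda>h. (B * h - h\<^sup>2) * exp (- \<alpha> * h) / (1 - exp (- \<alpha> * h) * (1 - h\<^sup>2))) \<longlongrightarrow> \<mu>) (at_right 0)"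
    using tendsto_diff[OF tendsto_mult[OF tendsto_const[of B] lims(1)] lims(2)]
    by (simp add: B diff_divide_distrib left_diff_distrib mult.assoc)
  \<comment> \<open>Once the denominator is positive, \<open>max 0\<close> may be taken of the whole
    quotient instead of its numerator; the limit is unaffected as
    \<open>\<mu> \<ge> 0\<close>.\<close>
  from tendsto_max[OF tendsto_const[of 0] this]
  show "(?a \<longlongrightarrow> \<mu>) (at_right 0)"
    unfolding max_absorb2[OF \<open>\<mu> \<ge> 0\<close>]
    by (rule Lim_transform_eventually)
      (use lims(3) in \<open>auto elim!: eventually_mono simp: max_def divide_le_0_iff zero_le_divide_iff\<close>)
qed simp

section \<open>Stieltjes integrals of powers\<close>

text \<open>Since \<open>F 0 = 0\<close>, there is no atom at 0: the closed interval lies between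
  \<open>{0<..x}\<close> and \<open>{-1<..x}\<close>, which both have mass
  \<open>F x\<close>.\<close>

lemma emeasure_interval_measure_Icc_0:
  assumes F: "distribution_function_nonneg F" and "F 0 = 0" "x \<ge> 0"
  shows "emeasure (interval_measure F) {0..x} = ennreal (F x)"
proof (rule antisym)
  have mono: "F a \<le> F b" if "a \<le> b" for a b
    using F that by (auto simp: distribution_function_nonneg_def mono_def)
  have rc: "continuous (at_right a) F" for a
    using F by (simp add: distribution_function_nonneg_def)
  have "F (-1) = 0" using F by (simp add: distribution_function_nonneg_def)
  then have "emeasure (interval_measure F) {-1<..x} = ennreal (F x)"
    using emeasure_interval_measure_Ioc[of "-1" x F, OF _ mono rc] \<open>x \<ge> 0\<close> by simp
  moreover have "emeasure (interval_measure F) {0..x} \<le> emeasure (interval_measure F) {-1<..x}"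
    by (rule emeasure_mono) auto
  ultimately show "emeasure (interval_measure F) {0..x} \<le> ennreal (F x)" by simp
  have "emeasure (interval_measure F) {0<..x} = ennreal (F x)"
    using emeasure_interval_measure_Ioc[of 0 x F, OF _ mono rc] \<open>x \<ge> 0\<close> \<open>F 0 = 0\<close> by simp
  moreover have "emeasure (interval_measure F) {0<..x} \<le> emeasure (interval_measure F) {0..x}"
    by (rule emeasure_mono) auto
  ultimately show "ennreal (F x) \<le> emeasure (interval_measure F) {0..x}" by simp
qed

lemma set_integrable_powr_Icc_0:
  assumes F: "distribution_function_nonneg F" and "F 0 = 0" "\<alpha> > 0"
  shows "set_integrable (interval_measure F) {0..x} (\<lambda>y. y powr \<alpha>)"
proof (cases "x \<ge> 0")
  case True
  show ?thesis unfolding set_integrable_def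
  proof (rule integrableI_bounded_set[where A = "{0..x}" and B = "x powr \<alpha>"])
    show "emeasure (interval_measure F) {0..x} < \<infinity>"
      using emeasure_interval_measure_Icc_0[OF F \<open>F 0 = 0\<close> True] by simp
    show "AE y in interval_measure F. y \<in> {0..x} \<longrightarrow> norm (indicat_real {0..x} y *\<^sub>R y powr \<alpha>) \<le> x powr \<alpha>"
      using \<open>\<alpha> > 0\<close> by (auto intro!: AE_I2 powr_mono2)
  qed (auto)
qed (simp add: set_integrable_def)

text \<open>The increment is the integral of the power over \<open>{x<..y}\<close>, a set of mass
  \<open>F y - F x\<close> on which the power is monotone. Together with
  \<open>williamson_eq\<close> this is all that the main argument uses about the integrals.\<close>

lemma trunc_moment_increment:
  assumes F: "distribution_function_nonneg F" and "F 0 = 0" "\<alpha> > 0" "0 < x" "x < y"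
  shows "x powr \<alpha> * (F y - F x) \<le> trunc_moment F \<alpha> y - trunc_moment F \<alpha> x"
    and "trunc_moment F \<alpha> y - trunc_moment F \<alpha> x \<le> y powr \<alpha> * (F y - F x)"
proof -
  have mono: "F a \<le> F b" if "a \<le> b" for a b
    using F that by (auto simp: distribution_function_nonneg_def mono_def)
  have rc: "continuous (at_right a) F" for a
    using F by (simp add: distribution_function_nonneg_def)
  let ?M = "interval_measure F"
  have em: "emeasure ?M {x<..y} = ennreal (F y - F x)"
    by (rule emeasure_interval_measure_Ioc[OF _ mono rc]) (use assms in simp_all)
  then have m: "measure ?M {x<..y} = F y - F x"
    using mono[of x y] assms by (simp add: measure_def)
  have int: "set_integrable ?M {x<..y} (\<lambda>y. y powr \<alpha>)"
    by (rule set_integrable_subset[OF set_integrable_powr_Icc_0[OF F \<open>F 0 = 0\<close> \<open>\<alpha> > 0\<close>, of y]])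
      (use assms in auto)
  have c: "set_integrable ?M {x<..y} (\<lambda>_. c)" for c :: real
    using em by (simp add: set_integrable_def)
  have lc: "(LINT _:{x<..y}|?M. c) = c * (F y - F x)" for c :: real
    using m em by (simp add: set_lebesgue_integral_def)
  have "{0..y} = {0..x} \<union> {x<..y}" "{0..x} \<inter> {x<..y} = {}" using assms by auto
  then have "trunc_moment F \<alpha> y = trunc_moment F \<alpha> x + (LINT u:{x<..y}|?M. u powr \<alpha>)"
    unfolding trunc_moment_def
    using set_integral_Un[OF _ set_integrable_powr_Icc_0[OF F \<open>F 0 = 0\<close> \<open>\<alpha> > 0\<close>, of x] int] by metis
  then have d: "trunc_moment F \<alpha> y - trunc_moment F \<alpha> x = (LINT u:{x<..y}|?M. u powr \<alpha>)" by simp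
  show "x powr \<alpha> * (F y - F x) \<le> trunc_moment F \<alpha> y - trunc_moment F \<alpha> x"
    unfolding d lc[symmetric]
    by (rule set_integral_mono[OF c int]) (use assms in \<open>auto intro!: powr_mono2\<close>)
  show "trunc_moment F \<alpha> y - trunc_moment F \<alpha> x \<le> y powr \<alpha> * (F y - F x)"
    unfolding d lc[symmetric]
    by (rule set_integral_mono[OF int c]) (use assms in \<open>auto intro!: powr_mono2\<close>)
qed

lemma williamson_eq:
  assumes F: "distribution_function_nonneg F" and "F 0 = 0" "\<alpha> > 0" "0 < x"
  shows "williamson F \<alpha> x = F x - trunc_moment F \<alpha> x / x powr \<alpha>"
proof -
  let ?M = "interval_measure F"
  have em: "emeasure ?M {0..x} = ennreal (F x)"
    by (rule emeasure_interval_measure_Icc_0) (use assms in auto)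
  have "F x \<ge> F 0"
    using F \<open>0 < x\<close> by (auto simp: distribution_function_nonneg_def mono_def)
  then have m: "measure ?M {0..x} = F x"
    using em \<open>F 0 = 0\<close> by (simp add: measure_def)
  have one: "set_integrable ?M {0..x} (\<lambda>_. 1 :: real)"
    using em by (simp add: set_integrable_def)
  have "williamson F \<alpha> x = (LINT t:{0..x}|?M. 1 - t powr \<alpha> / x powr \<alpha>)"
    unfolding williamson_def
    by (rule set_lebesgue_integral_cong) (use assms in \<open>auto simp: powr_divide\<close>)
  also have "\<dots> = (LINT t:{0..x}|?M. 1) - (LINT t:{0..x}|?M. t powr \<alpha> / x powr \<alpha>)"
    by (rule set_integral_diff(2)[OF one])
      (use set_integrable_powr_Icc_0[OF F \<open>F 0 = 0\<close> \<open>\<alpha> > 0\<close>, of x] in simp)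
  also have "(LINT t:{0..x}|?M. 1) = F x"
    using m em by (simp add: set_lebesgue_integral_def)
  finally show ?thesis by (simp add: trunc_moment_def)
qed

theorem theorem8:
  fixes F L :: "real \<Rightarrow> real" and \<alpha> \<beta> \<mu> :: real
  assumes "distribution_function_nonneg F"
    and "F 0 = 0"
    and "\<alpha> > 0"
    and "L \<in> RV0"
    and "\<beta> \<ge> 0"
    and "\<mu> \<ge> 0"
    and "\<beta> = \<alpha> * \<mu>"
  shows "((\<lambda>x. x powr \<alpha> * tail (williamson F \<alpha>) x) \<in> de_Haan \<beta> L \<longleftrightarrow>
          ((\<lambda>x. x powr \<alpha> * tail F x / L x) \<longlongrightarrow> \<mu>) at_top) \<and>
         (((\<lambda>x. x powr \<alpha> * tail F x / L x) \<longlongrightarrow> \<mu>) at_top \<longleftrightarrow>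
          trunc_moment F \<alpha> \<in> de_Haan \<beta> L)"
proof -
  define U where "U = (\<lambda>x. x powr \<alpha> * tail (williamson F \<alpha>) x)"
  define T where "T = tail F"
  define H where "H = trunc_moment F \<alpha>"
  note F = assms(1)
  have U: "U x = x powr \<alpha> * T x + H x" if "x > 0" for x
    using williamson_eq[OF assms(1-3) that] that
    by (simp add: U_def T_def H_def tail_def field_simps)
  have Tdiff: "F y - F x = T x - T y" for x y by (simp add: T_def tail_def)
  have H: "x powr \<alpha> * (T x - T y) \<le> H y - H x" "H y - H x \<le> y powr \<alpha> * (T x - T y)"
    if "0 < x" "x < y" for x y
    using trunc_moment_increment[OF assms(1-3) that] by (simp_all add: Tdiff H_def)
  \<comment> \<open>In \<open>U (t * x) - U x\<close>, inserting the left-endpoint bound for the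
    increment of \<open>H\<close> cancels the \<open>T x\<close> terms, and the right-endpoint bound
    cancels the \<open>T (t * x)\<close> terms.\<close>
  have lower: "(t powr \<alpha> - 1) * (x powr \<alpha> * T (t * x)) \<le> U (t * x) - U x"
    and upper: "U (t * x) - U x \<le> (t powr \<alpha> - 1) * (x powr \<alpha> * T x)" if "x > 0" "t > 1" for x t
  proof -
    have "x < t * x" "t * x > 0" "(t * x) powr \<alpha> = t powr \<alpha> * x powr \<alpha>" 
      using that by (auto simp: powr_mult)
    with H[of x "t * x"] that
    show "(t powr \<alpha> - 1) * (x powr \<alpha> * T (t * x)) \<le> U (t * x) - U x"
      "U (t * x) - U x \<le> (t powr \<alpha> - 1) * (x powr \<alpha> * T x)"
      by (simp_all add: U algebra_simps)
  qed
  have "(F \<longlongrightarrow> 1) at_top" using F by (simp add: distribution_function_nonneg_def)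
  then have T0: "(T \<longlongrightarrow> 0) at_top"
    unfolding T_def tail_def using tendsto_diff[OF tendsto_const[of 1]] by fastforce
  have Tpos: "T x \<ge> 0" for x
  proof -
    have "F x \<le> 1"
      using F by (intro tendsto_lowerbound[OF \<open>(F \<longlongrightarrow> 1) at_top\<close>] eventually_mono[OF eventually_ge_at_top[of x]])
        (auto simp: distribution_function_nonneg_def mono_def)
    then show ?thesis by (simp add: T_def tail_def)
  qed
  let ?b = "((\<lambda>x. x powr \<alpha> * T x / L x) \<longlongrightarrow> \<mu>) at_top"
  have ab: "U \<in> de_Haan \<beta> L \<longleftrightarrow> ?b"
    using tail_asymp_if_de_Haan[OF assms(3,4) lower upper, of \<mu>]
      de_Haan_if_tail_asymp[OF assms(3,4) lower upper, of \<mu>] assms(7) by blast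
  have "H \<in> de_Haan \<beta> L" if b: ?b
    unfolding de_Haan_def
  proof safe
    fix t :: real assume "t > 1"
    then have "t > 0" by simp
    \<comment> \<open>Passing from \<open>U\<close> to \<open>H\<close> removes the weighted tails
      at \<open>t * x\<close> and at \<open>x\<close>; divided by \<open>L x\<close>, both tend to
      \<open>\<mu>\<close>, so their contributions cancel.\<close>
    have "((\<lambda>x. (U (t * x) - U x) / L x - ((t * x) powr \<alpha> * T (t * x) / L (t * x)) * (L (t * x) / L x)
        + x powr \<alpha> * T x / L x) \<longlongrightarrow> \<beta> * ln t - \<mu> * 1 + \<mu>) at_top"
      using ab b \<open>t > 1\<close> assms(4)
      by (intro tendsto_add tendsto_diff tendsto_mult de_HaanD RV0_ratio
          tendsto_rescale[OF b]) auto
    then have "((\<lambda>x. (U (t * x) - U x) / L x - ((t * x) powr \<alpha> * T (t * x) / L (t * x)) * (L (t * x) / L x)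
        + x powr \<alpha> * T x / L x) \<longlongrightarrow> \<beta> * ln t) at_top" by simp
    then show "((\<lambda>x. (H (t * x) - H x) / L x) \<longlongrightarrow> \<beta> * ln t) at_top"
    proof (rule Lim_transform_eventually)
      show "\<forall>\<^sub>F x in at_top. (U (t * x) - U x) / L x - ((t * x) powr \<alpha> * T (t * x) / L (t * x)) * (L (t * x) / L x)
        + x powr \<alpha> * T x / L x = (H (t * x) - H x) / L x"
        using RV0_pos[OF assms(4)] eventually_rescale[OF RV0_pos[OF assms(4)] \<open>t > 0\<close>] eventually_gt_at_top[of 0]
      proof eventually_elim
        case (elim x)
        have "((t * x) powr \<alpha> * T (t * x) / L (t * x)) * (L (t * x) / L x) = (t * x) powr \<alpha> * T (t * x) / L x"
          using elim by simp
        then show ?case using elim \<open>t > 0\<close>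
          by (simp add: U flip: diff_divide_distrib add_divide_distrib)
      qed
    qed
  qed
  moreover have ?b if "H \<in> de_Haan \<beta> L"
    using tail_asymp_if_moment_de_Haan[OF assms(3,6,4) T0 Tpos H] that assms(7) by blast
  ultimately show ?thesis using ab unfolding U_def T_def H_def by blast
qed

end
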